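(* For every $k\ge1$ and $q\in\mathbb R^D$, the orthogonal polynomials are expressed in terms of the quasi-tau matrices and their discrete translations by $$P_{[k]}(q)=(-1)^k\,[N\Lambda]_{k-1}^+[T^{(Nq)}H]_{k-1}H_{[k-1]}^{-1}\,[N\Lambda]_{k-2}^+[T^{(Nq)}H]_{k-2}H_{[k-2]}^{-1}\cdots[N\Lambda]_0^+[T^{(Nq)}H]_0H_{[0]}^{-1}.$$
   Context: Let $D\ge 1$ and let $\mu$ be a Borel measure on $\Omega\subseteq\mathbb R^D$ with finite moments. For $k\in\mathbb Z_+$ let $[k]=\{\alpha\in\mathbb Z_+^D:|\alpha|=k\}$, ordered so that $\alpha>\alpha'$ iff at the first coordinate where they differ the entry of $\alpha$ is smaller. $\chi_{[k]}(x)$ is the column vector of monomials $x^\alpha$, $\alpha\in[k]$, and $\chi$ stacks $\chi_{[0]},\chi_{[1]},\dots$. Semi-infinite matrices are partitioned in blocks $A_{[k],[\ell]}\in\mathbb R^{|[k]|\times|[\ell]|}$. The moment matrix $G=\int_\Omega\chi\,d\mu\,\chi^\top$ is assumed to have a block Cholesky factorization $G=S^{-1}H(S^{-1})^\top$ with $S$ block lower triangular with identity diagonal blocks and $H=\operatorname{diag}(H_{[0]},H_{[1]},\dots)$ with invertible blocks (the quasi-tau matrices of $\mu$). The orthogonal polynomials are $P=S\chi$, with blocks $P_{[k]}$. Shift matrices: $\Lambda_b$ has as only nonzero blocks $(\Lambda_b)_{[k],[k+1]}$, with entries $\delta_{\alpha+e_b,\alpha'}$, $\alpha\in[k]$, $\alpha'\in[k+1]$;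 $n\cdot\Lambda=\sum_bn_b\Lambda_b$. Let $N=(n_{a,b})\in GL(\mathbb R^D)$ be invertible with rows $n_a$, $a=1,\dots,D$. Given $p\in\mathbb R^D$ (standing assumption: all $p_a\neq0$), $T_a^{(p)}$ denotes the elementary discrete flow $d\mu(x)\mapsto(n_a\cdot x-p_a)\,d\mu(x)$, and $T_a^{(p)}H_{[k]}$ is the $k$-th diagonal block of the factor $H$ in the block Cholesky factorization (assumed to exist) of the moment matrix of $(n_a\cdot x-p_a)d\mu(x)$. In the theorem this is used with $p=Nq$, i.e. $p_a=n_a\cdot q$. Define the stacked matrices $$[N\Lambda]_k=\begin{pmatrix}(n_1\cdot\Lambda)_{[k],[k+1]}\\ \vdots\\ (n_D\cdot\Lambda)_{[k],[k+1]}\end{pmatrix}\in\mathbb R^{D|[k]|\times|[k+1]|},\qquad [T^{(p)}H]_k=\begin{pmatrix}T_1^{(p)}H_{[k]}\\ \vdots\\ T_D^{(p)}H_{[k]}\end{pmatrix}\in\mathbb R^{D|[k]|\times|[k]|}.$$ $[N\Lambda]_k$ has full column rank and $[N\Lambda]_k^+=\big([N\Lambda]_k^\top[N\Lambda]_k\big)^{-1}[N\Lambda]_k^\top$ is its Moore–Penrose pseudo-inverse. *)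

theory Defs
  imports
    "HOL-Analysis.Analysis"
    "HOL-Library.Groups_Big_Fun"
    "Jordan_Normal_Form.Gauss_Jordan_Elimination"
begin

(* "$" is vec_nth throughout, not the index operation of the dynamically sized vectors. *)
no_notation vec_index (infixl "$" 100)

section \<open>Multi-indices and monomials\<close>

text \<open>The ambient space is \<^typ>\<open>real ^ 'n\<close>; the linear order of the index type \<^typ>\<open>'n\<close>
  numbers the coordinates.\<close>

definition multi_indices :: "nat \<Rightarrow> (nat ^ 'n::{finite,linorder}) set" where
  "multi_indices k = {\<alpha>. (\<Sum>b\<in>UNIV. \<alpha> $ b) = k}"

definition mi_less :: "nat ^ 'n::{finite,linorder} \<Rightarrow> nat ^ 'n::{finite,linorder} \<Rightarrow> bool" where
  "mi_less \<alpha> \<beta> \<longleftrightarrow> (\<exists>b. \<beta> $ b < \<alpha> $ b \<and> (\<forall>c<b. \<beta> $ c = \<alpha> $ c))"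

definition mi_list :: "nat \<Rightarrow> (nat ^ 'n::{finite,linorder}) list" where
  "mi_list k = (THE xs. sorted_wrt mi_less xs \<and> set xs = multi_indices k)"

definition mi_count :: "'n::{finite,linorder} itself \<Rightarrow> nat \<Rightarrow> nat" where
  "mi_count _ k = card (multi_indices k :: (nat ^ 'n::{finite,linorder}) set)"

definition mi_power :: "real ^ 'n::{finite,linorder} \<Rightarrow> nat ^ 'n::{finite,linorder} \<Rightarrow> real" where
  "mi_power x \<alpha> = (\<Prod>b\<in>UNIV. (x $ b) ^ (\<alpha> $ b))"

definition chi_block :: "nat \<Rightarrow> real ^ 'n::{finite,linorder} \<Rightarrow> real mat" where
  "chi_block k x = mat (mi_count TYPE('n) k) 1 (\<lambda>(i, _). mi_power x (mi_list k ! i))"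

section \<open>Semi-infinite block matrices\<close>

text \<open>A semi-infinite block matrix is given by its blocks \<open>A k l\<close>, of size \<open>d k\<close> times \<open>d l\<close>.
  The entries of a product are sums with finitely many nonzero terms, whenever one factor is
  block banded or triangular on the appropriate side.\<close>

type_synonym block_mat = "nat \<Rightarrow> nat \<Rightarrow> real mat"

definition block_matrix :: "(nat \<Rightarrow> nat) \<Rightarrow> block_mat \<Rightarrow> bool" where
  "block_matrix d A \<longleftrightarrow> (\<forall>k l. A k l \<in> carrier_mat (d k) (d l))"

definition block_mult :: "(nat \<Rightarrow> nat) \<Rightarrow> block_mat \<Rightarrow> block_mat \<Rightarrow> block_mat" where
  "block_mult d A B =
     (\<lambda>k l. mat (d k) (d l) (\<lambda>(i, j). Sum_any (\<lambda>m. (A k m * B m l) $$ (i, j))))"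

definition block_transpose :: "block_mat \<Rightarrow> block_mat" where
  "block_transpose A = (\<lambda>k l. transpose_mat (A l k))"

definition block_diag :: "(nat \<Rightarrow> nat) \<Rightarrow> (nat \<Rightarrow> real mat) \<Rightarrow> block_mat" where
  "block_diag d H = (\<lambda>k l. if k = l then H k else 0\<^sub>m (d k) (d l))"

definition block_one :: "(nat \<Rightarrow> nat) \<Rightarrow> block_mat" where
  "block_one d = block_diag d (\<lambda>k. 1\<^sub>m (d k))"

definition block_lower_unitriangular :: "(nat \<Rightarrow> nat) \<Rightarrow> block_mat \<Rightarrow> bool" where
  "block_lower_unitriangular d S \<longleftrightarrow>
     block_matrix d S \<and> (\<forall>k. S k k = 1\<^sub>m (d k)) \<and> (\<forall>k l. k < l \<longrightarrow> S k l = 0\<^sub>m (d k) (d l))"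

text \<open>Here \<open>R\<close> plays the role of the inverse of \<open>S\<close>, which exists and is unique.\<close>

definition block_cholesky ::
  "(nat \<Rightarrow> nat) \<Rightarrow> block_mat \<Rightarrow> block_mat \<Rightarrow> (nat \<Rightarrow> real mat) \<Rightarrow> bool" where
  "block_cholesky d G S H \<longleftrightarrow>
     block_lower_unitriangular d S \<and>
     (\<forall>k. H k \<in> carrier_mat (d k) (d k) \<and> invertible_mat (H k)) \<and>
     (\<exists>R. block_lower_unitriangular d R \<and>
          block_mult d R S = block_one d \<and> block_mult d S R = block_one d \<and>
          G = block_mult d (block_mult d R (block_diag d H)) (block_transpose R))"

section \<open>Moment matrices and orthogonal polynomials\<close>

text \<open>The moment matrix of the (in general signed) measure with density \<open>w\<close> with respect to \<open>\<mu>\<close>.\<close>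

definition moment_matrix ::
  "(real ^ 'n::{finite,linorder}) measure \<Rightarrow> (real ^ 'n::{finite,linorder} \<Rightarrow> real) \<Rightarrow> block_mat" where
  "moment_matrix \<mu> w =
     (\<lambda>k l. mat (mi_count TYPE('n) k) (mi_count TYPE('n) l)
       (\<lambda>(i, j). \<integral>x. mi_power x (mi_list k ! i) * mi_power x (mi_list l ! j) * w x \<partial>\<mu>))"

definition flow_density :: "real ^ 'n::{finite,linorder} \<Rightarrow> real \<Rightarrow> real ^ 'n::{finite,linorder} \<Rightarrow> real" where
  "flow_density n c = (\<lambda>x. n \<bullet> x - c)"

definition orth_poly :: "block_mat \<Rightarrow> nat \<Rightarrow> real ^ 'n::{finite,linorder} \<Rightarrow> real mat" where
  "orth_poly S k x =
     mat (mi_count TYPE('n) k) 1 (\<lambda>(i, j). Sum_any (\<lambda>l. (S k l * chi_block l x) $$ (i, j)))"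

section \<open>Shift matrices, stacking and pseudo-inverses\<close>

definition shift_matrix :: "'n::{finite,linorder} \<Rightarrow> block_mat" where
  "shift_matrix b =
     (\<lambda>k l. mat (mi_count TYPE('n) k) (mi_count TYPE('n) l)
       (\<lambda>(i, j). if l = k + 1 \<and> (mi_list k ! i :: nat ^ 'n::{finite,linorder}) + axis b 1 = mi_list l ! j
                 then 1 else 0))"

definition dot_shift :: "real ^ 'n::{finite,linorder} \<Rightarrow> block_mat" where
  "dot_shift n =
     (\<lambda>k l. mat (mi_count TYPE('n) k) (mi_count TYPE('n) l)
       (\<lambda>(i, j). \<Sum>b\<in>UNIV. n $ b * shift_matrix b k l $$ (i, j)))"

text \<open>The matrices \<open>A a\<close>, each of size \<open>r\<close> times \<open>c\<close>, on top of each other in increasing order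
  of \<open>a\<close>.\<close>

definition stack_mat :: "nat \<Rightarrow> nat \<Rightarrow> ('n::{finite,linorder} \<Rightarrow> real mat) \<Rightarrow> real mat" where
  "stack_mat r c A =
     mat (CARD('n) * r) c
       (\<lambda>(i, j). A (sorted_list_of_set (UNIV :: 'n set) ! (i div r)) $$ (i mod r, j))"

definition stacked_shift :: "real ^ 'n::{finite,linorder} ^ 'n::{finite,linorder} \<Rightarrow> nat \<Rightarrow> real mat" where
  "stacked_shift N k =
     stack_mat (mi_count TYPE('n) k) (mi_count TYPE('n) (k + 1))
       (\<lambda>a::'n. dot_shift (N $ a) k (k + 1))"

definition stacked_tau :: "('n::{finite,linorder} \<Rightarrow> nat \<Rightarrow> real mat) \<Rightarrow> nat \<Rightarrow> real mat" where
  "stacked_tau TH k =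
     stack_mat (mi_count TYPE('n) k) (mi_count TYPE('n) k) (\<lambda>a::'n. TH a k)"

text \<open>Unspecified for singular matrices.\<close>

definition inv_mat :: "real mat \<Rightarrow> real mat" where
  "inv_mat A = the (mat_inverse A)"

text \<open>The Moore--Penrose pseudo-inverse of a matrix of full column rank.\<close>

definition pinv_mat :: "real mat \<Rightarrow> real mat" where
  "pinv_mat A = inv_mat (transpose_mat A * A) * transpose_mat A"

text \<open>The product \<open>F (k - 1) * \<dots> * F 1 * F 0\<close>; the size of the unit matrix is the number of
  columns of \<open>F 0\<close>, which is 1 in the intended use.\<close>

definition descending_prod :: "(nat \<Rightarrow> real mat) \<Rightarrow> nat \<Rightarrow> real mat" where
  "descending_prod F k = foldr (\<lambda>j M. F j * M) (rev [0..<k]) (1\<^sub>m (dim_col (F 0)))"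

end

theory Submission
  imports Defs "Jordan_Normal_Form.Determinant"
begin

no_notation vec_index (infixl "$" 100)

text \<open>Let \<open>w\<^sub>a(x) = n\<^sub>a \<bullet> x - n\<^sub>a \<bullet> q\<close> and let \<open>P\<^sub>a\<close> be the orthogonal polynomials of
  \<open>w\<^sub>a d\<mu>\<close>.  Comparing leading terms and pairing with monomials of degree at most \<open>k\<close> gives the
  Christoffel relation
  \<open>w\<^sub>a P\<^sub>a\<^bsub>[k]\<^esub> = (n\<^sub>a \<bullet> \<Lambda>)\<^bsub>[k],[k+1]\<^esub> P\<^bsub>[k+1]\<^esub> + (T\<^sub>aH\<^bsub>[k]\<^esub>) H\<^bsub>[k]\<^esub>\<inverse> P\<^bsub>[k]\<^esub>\<close>.  Its left-hand side vanishes at \<open>q\<close>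
  for every \<open>a\<close>, so stacking over \<open>a\<close> and applying the left inverse \<open>[N\<Lambda>]\<^sub>k\<^sup>+\<close> expresses
  \<open>P\<^bsub>[k+1]\<^esub>(q)\<close> through \<open>P\<^bsub>[k]\<^esub>(q)\<close>; iterate down to \<open>P\<^bsub>[0]\<^esub> = 1\<close>.\<close>

section \<open>Enumerating the multi-indices\<close>

lemma finite_multi_indices: "finite (multi_indices k :: (nat ^ 'n::{finite,linorder}) set)"
proof (rule finite_subset)
  show "multi_indices k \<subseteq> vec_lambda ` (UNIV \<rightarrow>\<^sub>E {..k} :: ('n \<Rightarrow> nat) set)"
  proof
    fix \<alpha> :: "nat ^ 'n::{finite,linorder}" assume "\<alpha> \<in> multi_indices k"
    then have "\<alpha> $ b \<le> k" for b
      by (metis (mono_tags, lifting) finite UNIV_I mem_Collect_eq member_le_sum multi_indices_def zero_le)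
    then have "vec_nth \<alpha> \<in> UNIV \<rightarrow>\<^sub>E {..k}" by auto
    then show "\<alpha> \<in> vec_lambda ` (UNIV \<rightarrow>\<^sub>E {..k})"
      by (metis image_eqI vec_nth_inverse)
  qed
  show "finite (vec_lambda ` (UNIV \<rightarrow>\<^sub>E {..k} :: ('n \<Rightarrow> nat) set))"
    by (intro finite_imageI finite_PiE) auto
qed

text \<open>Linearity of the order is what makes the sorted enumeration \<open>mi_list\<close> well
  defined. Comparison is decided at the first differing coordinate: for transitivity this is the
  smaller of the two deciding coordinates, for totality the least element of the finite set of
  disagreements.\<close>

lemma linorder_mi_less:
  "class.linorder (\<lambda>\<alpha> \<beta> :: nat ^ 'n::{finite,linorder}. \<alpha> = \<beta> \<or> mi_less \<alpha> \<beta>) mi_less"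
proof -
  have asym: "\<not> mi_less \<beta> \<alpha>" if "mi_less \<alpha> \<beta>" for \<alpha> \<beta> :: "nat ^ 'n::{finite,linorder}"
    using that unfolding mi_less_def by (metis linorder_less_linear order.asym order_less_irrefl)
  have trans: "mi_less \<alpha> \<gamma>" if ab: "mi_less \<alpha> \<beta>" and bc: "mi_less \<beta> \<gamma>" for \<alpha> \<beta> \<gamma> :: "nat ^ 'n::{finite,linorder}"
  proof -
    from ab obtain b where b: "\<beta> $ b < \<alpha> $ b" "\<forall>c<b. \<beta> $ c = \<alpha> $ c" unfolding mi_less_def by auto
    from bc obtain b' where b': "\<gamma> $ b' < \<beta> $ b'" "\<forall>c<b'. \<gamma> $ c = \<beta> $ c" unfolding mi_less_def by auto
    show ?thesis unfolding mi_less_def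
    proof (intro exI conjI allI impI)
      show "\<gamma> $ min b b' < \<alpha> $ min b b'"
        using b b' by (cases b b' rule: linorder_cases) (auto simp: min_def)
      show "\<gamma> $ c = \<alpha> $ c" if "c < min b b'" for c
        using b b' that by auto
    qed
  qed
  have total: "mi_less \<alpha> \<beta> \<or> mi_less \<beta> \<alpha>" if "\<alpha> \<noteq> \<beta>" for \<alpha> \<beta> :: "nat ^ 'n::{finite,linorder}"
  proof -
    let ?D = "{b. \<alpha> $ b \<noteq> \<beta> $ b}"
    have "?D \<noteq> {}" using that by (auto simp: Finite_Cartesian_Product.vec_eq_iff)
    then have "Min ?D \<in> ?D" by (intro Min_in) auto
    moreover have "\<alpha> $ c = \<beta> $ c" if "c < Min ?D" for c
      using that by (metis (mono_tags, lifting) Min_le finite leD mem_Collect_eq)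
    ultimately show ?thesis unfolding mi_less_def
      by (metis (mono_tags, lifting) linorder_neqE_nat mem_Collect_eq)
  qed
  show ?thesis
    by unfold_locales (use asym trans total in blast)+
qed

text \<open>A finite subset of a linear order has exactly one strictly increasing enumeration, so
  the definite description behind \<open>mi_list\<close> denotes.\<close>

lemma
  shows set_mi_list: "set (mi_list k) = (multi_indices k :: (nat ^ 'n::{finite,linorder}) set)"
    and distinct_mi_list: "distinct (mi_list k :: (nat ^ 'n::{finite,linorder}) list)"
proof -
  interpret mi: linorder "\<lambda>\<alpha> \<beta> :: nat ^ 'n::{finite,linorder}. \<alpha> = \<beta> \<or> mi_less \<alpha> \<beta>" mi_less
    by (rule linorder_mi_less)
  have "\<exists>!xs. sorted_wrt mi_less xs \<and> set xs = (multi_indices k :: (nat ^ 'n::{finite,linorder}) set)"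
  proof (rule ex_ex1I)
    show "\<exists>xs. sorted_wrt mi_less xs \<and> set xs = (multi_indices k :: (nat ^ 'n::{finite,linorder}) set)"
      using mi.finite_set_strict_sorted[OF finite_multi_indices] by metis
  qed (metis mi.strict_sorted_equal)
  from theI'[OF this] have "sorted_wrt mi_less (mi_list k :: (nat ^ 'n::{finite,linorder}) list)"
    and set: "set (mi_list k) = (multi_indices k :: (nat ^ 'n::{finite,linorder}) set)"
    unfolding mi_list_def by blast+
  then show "set (mi_list k) = (multi_indices k :: (nat ^ 'n::{finite,linorder}) set)"
    "distinct (mi_list k :: (nat ^ 'n::{finite,linorder}) list)"
    using mi.strict_sorted_iff by blast+
qed

text \<open>Lets sums over matrix positions be rewritten as sums over multi-indices; its inverse
  turns a vector into a function of multi-indices.\<close>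

lemma bij_betw_mi_list:
  "bij_betw (\<lambda>i. mi_list k ! i) {..<mi_count TYPE('n::{finite,linorder}) k}
     (multi_indices k :: (nat ^ 'n::{finite,linorder}) set)"
proof -
  have "length (mi_list k :: (nat ^ 'n::{finite,linorder}) list) = mi_count TYPE('n) k"
    unfolding mi_count_def set_mi_list[symmetric] by (simp add: distinct_card distinct_mi_list)
  then show ?thesis
    by (intro bij_betw_nth) (auto simp: set_mi_list distinct_mi_list)
qed

lemma mi_list_nth:
  "i < mi_count TYPE('n) k \<Longrightarrow> (mi_list k ! i :: nat ^ 'n::{finite,linorder}) \<in> multi_indices k"
  using bij_betw_mi_list[where 'n='n, of k] by (auto simp: bij_betw_def)

lemma mi_list_nth_obtain:
  assumes "(\<alpha> :: nat ^ 'n::{finite,linorder}) \<in> multi_indices k"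
  obtains i where "i < mi_count TYPE('n) k" "mi_list k ! i = \<alpha>"
  using bij_betw_mi_list[where 'n='n, of k] assms unfolding bij_betw_def
  by (metis (mono_tags, lifting) image_iff lessThan_iff)

lemma multi_indices_0: "multi_indices 0 = {0 :: nat ^ 'n::{finite,linorder}}"
  by (auto simp: multi_indices_def Finite_Cartesian_Product.vec_eq_iff)

lemma mi_count_0: "mi_count TYPE('n::{finite,linorder}) 0 = 1"
  by (simp add: mi_count_def multi_indices_0)

lemma mi_list_0: "mi_list 0 ! 0 = (0 :: nat ^ 'n::{finite,linorder})"
  using mi_list_nth[of 0 0, where 'n = 'n] by (simp add: mi_count_0 multi_indices_0)

section \<open>Shifts of multi-indices and multiplication by linear forms\<close>

lemma plus_axis_in_multi_indices:
  "\<alpha> \<in> multi_indices k \<Longrightarrow> (\<alpha> + axis b 1 :: nat ^ 'n::{finite,linorder}) \<in> multi_indices (k + 1)"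
  by (simp add: multi_indices_def sum.distrib axis_def)

lemma mi_power_plus: "mi_power x (\<alpha> + \<beta>) = mi_power x \<alpha> * mi_power x \<beta>"
  by (simp add: mi_power_def power_add prod.distrib)

lemma mi_power_axis: "mi_power x (axis b 1) = x $ b"
proof -
  have "mi_power x (axis b 1) = (\<Prod>c\<in>UNIV. if c = b then x $ c else 1)"
    unfolding mi_power_def by (intro prod.cong) (auto simp: axis_def)
  then show ?thesis by simp
qed

text \<open>The row of a multi-index \<open>\<alpha>\<close> carries the coefficient
  \<open>n $ b\<close> in the column of \<open>\<alpha> + axis b 1\<close>, so the sum over columns
  collapses to one over coordinates. An arbitrary \<open>f\<close> serves both monomials and kernel
  vectors.\<close>

lemma sum_dot_shift:
  assumes i: "i < mi_count TYPE('n::{finite,linorder}) k"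
  shows "(\<Sum>j<mi_count TYPE('n) (k + 1).
      dot_shift (n :: real ^ 'n::{finite,linorder}) k (k + 1) $$ (i, j) * f (mi_list (k + 1) ! j :: nat ^ 'n::{finite,linorder}))
    = (\<Sum>b\<in>UNIV. n $ b * f (mi_list k ! i + axis b 1))"
proof -
  let ?\<alpha> = "mi_list k ! i :: nat ^ 'n::{finite,linorder}"
  have "(\<Sum>j<mi_count TYPE('n) (k + 1).
      dot_shift n k (k + 1) $$ (i, j) * f (mi_list (k + 1) ! j))
    = (\<Sum>j<mi_count TYPE('n) (k + 1). \<Sum>b\<in>UNIV.
        if ?\<alpha> + axis b 1 = mi_list (k + 1) ! j then n $ b * f (mi_list (k + 1) ! j) else 0)"
    using i by (intro sum.cong)
      (auto simp: dot_shift_def shift_matrix_def sum_distrib_right intro!: sum.cong)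
  also have "\<dots> = (\<Sum>\<beta>\<in>multi_indices (k + 1). \<Sum>b\<in>UNIV.
        if ?\<alpha> + axis b 1 = \<beta> then n $ b * f \<beta> else 0)"
    by (rule sum.reindex_bij_betw[OF bij_betw_mi_list])
  also have "\<dots> = (\<Sum>b\<in>UNIV. \<Sum>\<beta>\<in>multi_indices (k + 1).
        if ?\<alpha> + axis b 1 = \<beta> then n $ b * f \<beta> else 0)"
    by (rule sum.swap)
  also have "\<dots> = (\<Sum>b\<in>UNIV. n $ b * f (?\<alpha> + axis b 1))"
    using plus_axis_in_multi_indices[OF mi_list_nth[OF i]]
    by (intro sum.cong) (auto simp: finite_multi_indices)
  finally show ?thesis .
qed

text \<open>The eigenvalue relation of the shift matrices: \<open>x $ b\<close> times a monomial is
  the monomial of the shifted multi-index.\<close>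

lemma dot_shift_apply_monomials:
  assumes "i < mi_count TYPE('n::{finite,linorder}) k"
  shows "(\<Sum>j<mi_count TYPE('n) (k + 1).
      dot_shift (n :: real ^ 'n::{finite,linorder}) k (k + 1) $$ (i, j) * mi_power x (mi_list (k + 1) ! j))
    = (n \<bullet> x) * mi_power x (mi_list k ! i)"
  unfolding sum_dot_shift[OF assms]
  by (simp add: mi_power_plus mi_power_axis inner_vec_def sum_distrib_right sum_distrib_left mult_ac
      del: One_nat_def)

text \<open>This is the full column rank of the stacked shift. Each multi-index of degree
  \<open>k + 1\<close> has the form \<open>\<alpha> + axis b 1\<close> with \<open>\<alpha>\<close>
  of degree \<open>k\<close>. The rows of \<open>\<alpha>\<close>, taken for all \<open>a\<close>,
  say that \<open>N\<close> annihilates the vector of values at all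
  \<open>\<alpha> + axis c 1\<close>, so invertibility of \<open>N\<close> makes these values
  zero.\<close>

lemma dot_shift_kernel_trivial:
  fixes N :: "real ^ 'n::{finite,linorder} ^ 'n::{finite,linorder}"
  assumes N: "invertible N"
    and zero: "\<And>a i. i < mi_count TYPE('n) k \<Longrightarrow>
        (\<Sum>j<mi_count TYPE('n) (k + 1). dot_shift (N $ a) k (k + 1) $$ (i, j) * v j) = 0"
    and j: "j < mi_count TYPE('n) (k + 1)"
  shows "v j = 0"
proof -
  \<comment> \<open>The entries of \<open>v\<close> are numbered by positions in
    \<open>mi_list (k + 1)\<close>; \<open>f\<close> holds the same entries indexed by
    multi-indices, as \<open>sum_dot_shift\<close> requires.\<close>
  define f where "f = (\<lambda>\<beta> :: nat ^ 'n::{finite,linorder}. v (inv_into {..<mi_count TYPE('n) (k + 1)} (\<lambda>i. mi_list (k + 1) ! i) \<beta>))"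
  have f: "f (mi_list (k + 1) ! j) = v j" if "j < mi_count TYPE('n) (k + 1)" for j
    using that bij_betw_mi_list[where 'n='n, of "k + 1"]
    by (simp add: f_def bij_betw_def inv_into_f_f)
  let ?\<beta> = "mi_list (k + 1) ! j :: nat ^ 'n::{finite,linorder}"
  have \<beta>: "?\<beta> \<in> multi_indices (k + 1)" by (rule mi_list_nth[OF j])
  then obtain b where b: "?\<beta> $ b > 0"
    by (fastforce simp: multi_indices_def intro: gr0I)
  \<comment> \<open>Subtraction of naturals truncates at zero, but the multi-index is positive at
    \<open>b\<close>, so adding the axis vector back recovers it.\<close>
  define \<alpha> where "\<alpha> = ?\<beta> - axis b 1"
  have \<alpha>\<beta>: "\<alpha> + axis b 1 = ?\<beta>"
    using b by (auto simp: \<alpha>_def Finite_Cartesian_Product.vec_eq_iff axis_def)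
  have "\<alpha> \<in> multi_indices k"
  proof -
    have "(\<Sum>c\<in>UNIV. (\<alpha> + axis b 1) $ c) = k + 1"
      using \<beta> unfolding \<alpha>\<beta> multi_indices_def by simp
    then show ?thesis by (simp add: multi_indices_def sum.distrib axis_def)
  qed
  then obtain i where i: "i < mi_count TYPE('n) k" "mi_list k ! i = \<alpha>"
    by (rule mi_list_nth_obtain)
  define g where "g = (\<chi> c. f (\<alpha> + axis c 1))"
  have "(N *v g) $ a = 0" for a
  proof -
    have "(\<Sum>c\<in>UNIV. N $ a $ c * f (\<alpha> + axis c 1)) =
      (\<Sum>j<mi_count TYPE('n) (k + 1). dot_shift (N $ a) k (k + 1) $$ (i, j) * f (mi_list (k + 1) ! j))"
      unfolding sum_dot_shift[OF i(1)] i(2) ..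
    also have "\<dots> = 0" using zero[OF i(1), of a] f by simp
    finally show ?thesis by (simp add: matrix_vector_mult_def g_def)
  qed
  then have "N *v g = 0" by (simp add: Finite_Cartesian_Product.vec_eq_iff)
  then have "g = 0" using N matrix_left_invertible_ker[of N]
    by (auto simp: invertible_def)
  then have "f ?\<beta> = 0" using \<alpha>\<beta> by (metis g_def vec_lambda_beta zero_index)
  then show ?thesis using f[OF j] by simp
qed


section \<open>Block matrices as kernels\<close>

text \<open>Pairs of a block number and a position inside that block, cut off at block
  \<open>K\<close>. Products with a triangular factor become finite sums over this set.\<close>

definition block_index :: "(nat \<Rightarrow> nat) \<Rightarrow> nat \<Rightarrow> (nat \<times> nat) set" where
  "block_index d K = (SIGMA k:{..K}. {..<d k})"

definition block_entry :: "block_mat \<Rightarrow> nat \<times> nat \<Rightarrow> nat \<times> nat \<Rightarrow> real" where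
  "block_entry A u v = A (fst u) (fst v) $$ (snd u, snd v)"

lemma finite_block_index [simp]: "finite (block_index d K)"
  by (simp add: block_index_def)

lemma mem_block_index [simp]: "(k, i) \<in> block_index d K \<longleftrightarrow> k \<le> K \<and> i < d k"
  by (simp add: block_index_def)

lemma block_indexE:
  assumes "u \<in> block_index d K"
  obtains k i where "u = (k, i)" "k \<le> K" "i < d k"
  using assms by (auto simp: block_index_def)

lemma sum_block_index: "sum f (block_index d K) = (\<Sum>k\<le>K. \<Sum>i<d k. f (k, i))"
  unfolding block_index_def by (subst sum.Sigma) auto

lemma sum_block_index_single:
  assumes "l \<le> K" and "\<And>m j. m \<le> K \<Longrightarrow> m \<noteq> l \<Longrightarrow> j < d m \<Longrightarrow> f (m, j) = 0"
  shows "sum f (block_index d K) = (\<Sum>j<d l. f (l, j))"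
proof -
  have "sum f (block_index d K) = (\<Sum>m\<le>K. if m = l then \<Sum>j<d m. f (m, j) else 0)"
    unfolding sum_block_index using assms(2) by (intro sum.cong) auto
  then show ?thesis using assms(1) by simp
qed

lemma sum_block_index_Suc:
  "sum f (block_index d (Suc K)) = sum f (block_index d K) + (\<Sum>i<d (Suc K). f (Suc K, i))"
  by (simp add: sum_block_index)

lemma block_matrix_carrier: "block_matrix d A \<Longrightarrow> A k l \<in> carrier_mat (d k) (d l)"
  by (simp add: block_matrix_def)

lemma index_mult_mat_sum:
  assumes "A \<in> carrier_mat m n" "B \<in> carrier_mat n p" "i < m" "j < p"
  shows "(A * B) $$ (i, j) = (\<Sum>s<n. A $$ (i, s) * B $$ (s, j))"
  using assms by (auto simp: scalar_prod_def atLeast0LessThan intro!: sum.cong)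

lemma block_lower_unitriangular_zero:
  "block_lower_unitriangular d S \<Longrightarrow> k < l \<Longrightarrow> i < d k \<Longrightarrow> j < d l \<Longrightarrow> block_entry S (k, i) (l, j) = 0"
  by (simp add: block_lower_unitriangular_def block_entry_def)

lemma block_lower_unitriangular_diag:
  "block_lower_unitriangular d S \<Longrightarrow> i < d k \<Longrightarrow> j < d k \<Longrightarrow>
    block_entry S (k, i) (k, j) = (if i = j then 1 else 0)"
  by (simp add: block_lower_unitriangular_def block_entry_def)

text \<open>Block row \<open>k\<close> of \<open>S\<close> ends at the diagonal, so every cutoff
  \<open>K\<close> from \<open>k\<close> on gives the same value. The family \<open>B\<close> covers
  both the block columns of a matrix and the monomial vectors \<open>chi_block\<close>.\<close>

lemma Sum_any_lower_triangular:
  assumes S: "block_lower_unitriangular d S"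
    and B: "\<And>m. B m \<in> carrier_mat (d m) p" and i: "i < d k" and j: "j < p" and K: "k \<le> K"
  shows "Sum_any (\<lambda>m. (S k m * B m) $$ (i, j))
    = (\<Sum>w\<in>block_index d K. block_entry S (k, i) w * B (fst w) $$ (snd w, j))"
proof -
  have entry: "(S k m * B m) $$ (i, j) = (\<Sum>s<d m. S k m $$ (i, s) * B m $$ (s, j))" for m
    using S B i j unfolding block_lower_unitriangular_def block_matrix_def
    by (intro index_mult_mat_sum) auto
  have "(S k m * B m) $$ (i, j) = 0" if "k < m" for m
    unfolding entry using S i that by (simp add: block_lower_unitriangular_def)
  \<comment> \<open>\<open>Sum_any\<close> is zero by convention on infinite support, so the support
    is first enclosed in a finite set.\<close>
  then have "{m. (S k m * B m) $$ (i, j) \<noteq> 0} \<subseteq> {..K}"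
    using K by (force simp: not_le[symmetric])
  then have "Sum_any (\<lambda>m. (S k m * B m) $$ (i, j)) = (\<Sum>m\<le>K. (S k m * B m) $$ (i, j))"
    by (intro Sum_any.expand_superset) auto
  then show ?thesis
    by (simp add: entry sum_block_index block_entry_def)
qed

lemma block_entry_mult_lower_triangular:
  assumes S: "block_lower_unitriangular d S" and B: "block_matrix d B"
    and "i < d k" and "j < d l" and "k \<le> K"
  shows "block_entry (block_mult d S B) (k, i) (l, j)
    = (\<Sum>w\<in>block_index d K. block_entry S (k, i) w * block_entry B w (l, j))"
  using Sum_any_lower_triangular[OF S, of "\<lambda>m. B m l" "d l" i k j K] assms block_matrix_carrier[OF B]
  by (simp add: block_mult_def block_entry_def)

lemma block_matrix_mult: "block_matrix d (block_mult d A B)"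
  by (simp add: block_matrix_def block_mult_def)

lemma block_entry_one:
  "i < d k \<Longrightarrow> j < d l \<Longrightarrow> block_entry (block_one d) (k, i) (l, j) = (if (k, i) = (l, j) then 1 else 0)"
  by (auto simp: block_one_def block_diag_def block_entry_def)

text \<open>Triangularity lets the inverse relation survive truncation at block
  \<open>K\<close>.\<close>

lemma block_entry_left_inverse:
  assumes R: "block_lower_unitriangular d R" and S: "block_matrix d S"
    and RS: "block_mult d R S = block_one d"
    and u: "u \<in> block_index d K" and v: "v \<in> block_index d K"
  shows "(\<Sum>w\<in>block_index d K. block_entry R u w * block_entry S w v) = (if u = v then 1 else 0)"
proof -
  obtain k i l j where "u = (k, i)" "v = (l, j)" "k \<le> K" "i < d k" "j < d l"
    using u v by (auto simp: block_index_def)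
  then show ?thesis
    using block_entry_mult_lower_triangular[OF R S, of i k j l K] by (simp add: RS block_entry_one)
qed

section \<open>Orthogonality and nondegeneracy of a Cholesky factorization\<close>

text \<open>Entrywise form of \<open>S G = H R^T\<close>, which follows from
  \<open>G = R H R^T\<close> by cancelling \<open>S\<close> against \<open>R\<close>. The work lies
  in reducing each block product to a finite sum so that the order of summation can be
  exchanged.\<close>

lemma cholesky_left_mult:
  assumes S: "block_lower_unitriangular d S"
    and H: "\<And>k. H k \<in> carrier_mat (d k) (d k)"
    and R: "block_lower_unitriangular d R" and SR: "block_mult d S R = block_one d"
    and G: "G = block_mult d (block_mult d R (block_diag d H)) (block_transpose R)"
    and i: "i < d k" and j: "j < d l" and K: "k \<le> K"
  shows "(\<Sum>w\<in>block_index d K. block_entry S (k, i) w * block_entry G w (l, j))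
    = (\<Sum>s<d k. H k $$ (i, s) * block_entry R (l, j) (k, s))"
proof -
  have bS: "block_matrix d S" and bR: "block_matrix d R"
    using S R by (auto simp: block_lower_unitriangular_def)
  have bD: "block_matrix d (block_diag d H)"
    using H by (auto simp: block_matrix_def block_diag_def)
  have bT: "block_matrix d (block_transpose R)"
    using bR by (auto simp: block_matrix_def block_transpose_def)
  note SR' = block_entry_left_inverse[OF S bR SR]
  \<comment> \<open>The inner product \<open>R H\<close> is again block lower triangular, but with
    the blocks \<open>H k\<close> on its diagonal instead of unit matrices.\<close>
  define E where "E = block_mult d R (block_diag d H)"
  have E: "block_entry E (k, i) (l, j) = (\<Sum>s<d l. block_entry R (k, i) (l, s) * H l $$ (s, j))"
    if "i < d k" "j < d l" for k i l j
  proof -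
    \<comment> \<open>The cutoff \<open>max k l\<close> is at least \<open>k\<close>, as
      triangularity of \<open>R\<close> demands, and at least \<open>l\<close>, so that the one
      surviving block is in range.\<close>
    have "block_entry E (k, i) (l, j) = (\<Sum>w\<in>block_index d (max k l).
        block_entry R (k, i) w * block_entry (block_diag d H) w (l, j))"
      unfolding E_def using that by (intro block_entry_mult_lower_triangular R bD) auto
    also have "\<dots> = (\<Sum>s<d l. block_entry R (k, i) (l, s) * block_entry (block_diag d H) (l, s) (l, j))"
      using that by (intro sum_block_index_single) (auto simp: block_entry_def block_diag_def)
    finally show ?thesis by (simp add: block_entry_def block_diag_def)
  qed
  have E_zero: "E k m = 0\<^sub>m (d k) (d m)" if "k < m" for k m
  proof (rule eq_matI)
    show "dim_row (E k m) = dim_row (0\<^sub>m (d k) (d m))" "dim_col (E k m) = dim_col (0\<^sub>m (d k) (d m))"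
      by (simp_all add: E_def block_mult_def)
    show "E k m $$ (i, j) = 0\<^sub>m (d k) (d m) $$ (i, j)"
      if ij: "i < dim_row (0\<^sub>m (d k) (d m))" "j < dim_col (0\<^sub>m (d k) (d m))" for i j
      using E[of i k j m] ij block_lower_unitriangular_zero[OF R \<open>k < m\<close>]
      by (simp add: block_entry_def)
  qed
  \<comment> \<open>The transpose of \<open>R\<close> is upper triangular, so the finite support
    comes from \<open>E\<close>, whose block rows end at the diagonal.\<close>
  have G_entry: "block_entry G u (l, j)
      = (\<Sum>w\<in>block_index d K. block_entry E u w * block_entry R (l, j) w)"
    if u: "u \<in> block_index d K" and j: "j < d l" for u l j K
  proof -
    have entry: "(E (fst u) m * transpose_mat (R l m)) $$ (snd u, j)
        = (\<Sum>s<d m. block_entry E u (m, s) * block_entry R (l, j) (m, s))" for m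
      using u j block_matrix_carrier[OF bR, of l m] block_matrix_carrier[OF block_matrix_mult, of d R _ "fst u" m]
      by (subst index_mult_mat_sum[of _ "d (fst u)" "d m" _ "d l"])
        (auto simp: E_def block_entry_def block_index_def)
    have "{m. (E (fst u) m * transpose_mat (R l m)) $$ (snd u, j) \<noteq> 0} \<subseteq> {..K}"
    proof (rule subsetI, rule ccontr)
      fix m assume m: "m \<in> {m. (E (fst u) m * transpose_mat (R l m)) $$ (snd u, j) \<noteq> 0}" "m \<notin> {..K}"
      then have "fst u < m" using u by (auto simp: block_index_def)
      with m(1) u show False unfolding entry
        by (auto simp: block_entry_def E_zero block_index_def)
    qed
    then have "Sum_any (\<lambda>m. (E (fst u) m * transpose_mat (R l m)) $$ (snd u, j))
        = (\<Sum>m\<le>K. (E (fst u) m * transpose_mat (R l m)) $$ (snd u, j))"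
      by (intro Sum_any.expand_superset) auto
    moreover have "block_entry G u (l, j)
        = Sum_any (\<lambda>m. (E (fst u) m * transpose_mat (R l m)) $$ (snd u, j))"
      using u j unfolding G E_def[symmetric] block_entry_def block_mult_def[of d E] block_transpose_def
      by (auto simp: block_index_def)
    ultimately show ?thesis unfolding entry by (simp add: sum_block_index)
  qed
  \<comment> \<open>Here \<open>S\<close> cancels \<open>R\<close> and leaves the diagonal
    factor.\<close>
  have SE: "(\<Sum>w\<in>block_index d K. block_entry S (k, i) w * block_entry E w (m, s))
      = (if m = k then H k $$ (i, s) else 0)" if "m \<le> K" "s < d m" for m s
  proof -
    have "(\<Sum>w\<in>block_index d K. block_entry S (k, i) w * block_entry E w (m, s))
      = (\<Sum>w\<in>block_index d K. \<Sum>t<d m. block_entry S (k, i) w * block_entry R w (m, t) * H m $$ (t, s))"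
      using that by (intro sum.cong refl) (auto simp: E block_index_def sum_distrib_left mult_ac)
    also have "\<dots> = (\<Sum>t<d m. (\<Sum>w\<in>block_index d K. block_entry S (k, i) w * block_entry R w (m, t)) * H m $$ (t, s))"
      unfolding sum_distrib_right by (rule sum.swap)
    also have "\<dots> = (\<Sum>t<d m. if k = m \<and> i = t then H m $$ (t, s) else 0)"
      using that i K by (intro sum.cong refl) (auto simp: SR')
    finally show ?thesis using i by (cases "m = k") auto
  qed
  have "(\<Sum>w\<in>block_index d K. block_entry S (k, i) w * block_entry G w (l, j))
    = (\<Sum>w\<in>block_index d K. \<Sum>v\<in>block_index d K.
        block_entry S (k, i) w * block_entry E w v * block_entry R (l, j) v)"
    using j by (intro sum.cong refl) (simp add: G_entry sum_distrib_left mult_ac)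
  also have "\<dots> = (\<Sum>v\<in>block_index d K. (\<Sum>w\<in>block_index d K.
        block_entry S (k, i) w * block_entry E w v) * block_entry R (l, j) v)"
    unfolding sum_distrib_right by (rule sum.swap)
  also have "\<dots> = (\<Sum>s<d k. (\<Sum>w\<in>block_index d K.
        block_entry S (k, i) w * block_entry E w (k, s)) * block_entry R (l, j) (k, s))"
    using K by (intro sum_block_index_single) (auto simp: SE)
  also have "\<dots> = (\<Sum>s<d k. H k $$ (i, s) * block_entry R (l, j) (k, s))"
    using K by (intro sum.cong refl) (auto simp: SE)
  finally show ?thesis .
qed

text \<open>The product \<open>S G = H R^T\<close> is block upper triangular with diagonal
  \<open>H\<close>. For a moment matrix this says that block \<open>k\<close> of the orthogonal
  polynomials annihilates the monomials of degree below \<open>k\<close> and pairs to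
  \<open>H k\<close> with those of degree \<open>k\<close>.\<close>

lemma block_cholesky_orthogonal:
  assumes chol: "block_cholesky d G S H" and "i < d k" "j < d l" "l \<le> k" "k \<le> K"
  shows "(\<Sum>w\<in>block_index d K. block_entry S (k, i) w * block_entry G w (l, j))
    = (if l = k then H k $$ (i, j) else 0)"
proof -
  obtain R where S: "block_lower_unitriangular d S"
    and H: "\<And>k. H k \<in> carrier_mat (d k) (d k)"
    and R: "block_lower_unitriangular d R"
    and RS: "block_mult d R S = block_one d" and SR: "block_mult d S R = block_one d"
    and G: "G = block_mult d (block_mult d R (block_diag d H)) (block_transpose R)"
    using chol unfolding block_cholesky_def by blast
  note SG = cholesky_left_mult[OF S H R SR G]
  show ?thesis
  proof (cases "l = k")
    case True
    then have "(\<Sum>s<d k. H k $$ (i, s) * block_entry R (l, j) (k, s))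
      = (\<Sum>s<d k. if s = j then H k $$ (i, s) else 0)"
      using assms R by (intro sum.cong) (auto simp: block_lower_unitriangular_diag)
    then show ?thesis using assms True by (simp add: SG)
  next
    case False
    then have "(\<Sum>s<d k. H k $$ (i, s) * block_entry R (l, j) (k, s)) = 0"
      using assms R by (intro sum.neutral) (auto simp: block_lower_unitriangular_zero)
    then show ?thesis using assms False by (simp add: SG)
  qed
qed

text \<open>\<open>inv_mat\<close> is meaningful only if \<open>mat_inverse\<close> succeeds. A
  one-sided inverse of a square matrix is two-sided, which makes \<open>A\<close> a unit and
  guarantees success.\<close>

lemma inv_mat:
  assumes "A \<in> carrier_mat n n" "B \<in> carrier_mat n n" "B * A = 1\<^sub>m n"
  shows "inv_mat A \<in> carrier_mat n n" "A * inv_mat A = 1\<^sub>m n" "inv_mat A * A = 1\<^sub>m n"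
proof -
  have "A \<in> Units (ring_mat TYPE(real) n ())"
    using assms mat_mult_left_right_inverse[OF assms(2,1,3)] by (auto simp: Units_def ring_mat_def)
  then obtain C where "mat_inverse A = Some C"
    using mat_inverse(1)[OF assms(1), where b="()"] by (cases "mat_inverse A") auto
  then show "inv_mat A \<in> carrier_mat n n" "A * inv_mat A = 1\<^sub>m n" "inv_mat A * A = 1\<^sub>m n"
    using mat_inverse(2)[OF assms(1)] by (auto simp: inv_mat_def)
qed

lemma inv_mat_invertible_mat:
  assumes "A \<in> carrier_mat n n" "invertible_mat A"
  shows "inv_mat A \<in> carrier_mat n n" "A * inv_mat A = 1\<^sub>m n" "inv_mat A * A = 1\<^sub>m n"
proof -
  obtain B where "A * B = 1\<^sub>m (dim_row A)" "B * A = 1\<^sub>m (dim_row B)"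
    using assms(2) by (auto simp: invertible_mat_def inverts_mat_def)
  \<comment> \<open>The witness from \<open>invertible_mat\<close> comes without dimensions; they
    are read off the two identities.\<close>
  moreover from this have "B \<in> carrier_mat n n"
    using assms(1) by (metis carrier_matD carrier_matI index_mult_mat(2,3) index_one_mat(2,3))
  ultimately show "inv_mat A \<in> carrier_mat n n" "A * inv_mat A = 1\<^sub>m n" "inv_mat A * A = 1\<^sub>m n"
    using assms(1) inv_mat[of A n B] by auto
qed

text \<open>Symmetry turns \<open>c^T G = 0\<close> into \<open>G c = 0\<close>. Multiplying by
  \<open>S\<close> gives \<open>H g = 0\<close> with \<open>g = R^T c\<close>, so
  \<open>g = 0\<close> since the blocks of \<open>H\<close> are invertible, and then
  \<open>c = S^T g = 0\<close> because \<open>R S = 1\<close>.\<close>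

lemma block_cholesky_nondegenerate:
  assumes chol: "block_cholesky d G S H"
    and sym: "\<And>u v. u \<in> block_index d K \<Longrightarrow> v \<in> block_index d K \<Longrightarrow> block_entry G u v = block_entry G v u"
    and zero: "\<And>v. v \<in> block_index d K \<Longrightarrow> (\<Sum>u\<in>block_index d K. c u * block_entry G u v) = 0"
    and u: "u \<in> block_index d K"
  shows "c u = 0"
proof -
  obtain R where S: "block_lower_unitriangular d S"
    and H: "\<And>k. H k \<in> carrier_mat (d k) (d k)"
    and R: "block_lower_unitriangular d R"
    and RS: "block_mult d R S = block_one d" and SR: "block_mult d S R = block_one d"
    and G: "G = block_mult d (block_mult d R (block_diag d H)) (block_transpose R)"
    using chol unfolding block_cholesky_def by blast
  note SG = cholesky_left_mult[OF S H R SR G]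
  have "block_matrix d S" using S by (simp add: block_lower_unitriangular_def)
  note RS' = block_entry_left_inverse[OF R this RS]
  define g where "g = (\<lambda>w. \<Sum>u\<in>block_index d K. c u * block_entry R u w)"
  have Hg: "(\<Sum>s<d k. H k $$ (i, s) * g (k, s)) = 0" if "k \<le> K" "i < d k" for k i
  proof -
    have "(\<Sum>s<d k. H k $$ (i, s) * g (k, s))
      = (\<Sum>v\<in>block_index d K. c v * (\<Sum>s<d k. H k $$ (i, s) * block_entry R v (k, s)))"
      unfolding g_def sum_distrib_left by (subst sum.swap) (simp add: mult_ac)
    also have "\<dots> = (\<Sum>v\<in>block_index d K. c v *
        (\<Sum>w\<in>block_index d K. block_entry S (k, i) w * block_entry G w v))"
      using that by (intro sum.cong refl) (auto simp: SG elim!: block_indexE)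
    also have "\<dots> = (\<Sum>w\<in>block_index d K. block_entry S (k, i) w *
        (\<Sum>v\<in>block_index d K. c v * block_entry G w v))"
      unfolding sum_distrib_left by (subst sum.swap) (simp add: mult_ac)
    also have "\<dots> = (\<Sum>w\<in>block_index d K. block_entry S (k, i) w *
        (\<Sum>v\<in>block_index d K. c v * block_entry G v w))"
      by (intro sum.cong refl arg_cong2[where f="(*)"]) (simp add: sym)
    finally show ?thesis by (simp add: zero)
  qed
  have g: "g w = 0" if w: "w \<in> block_index d K" for w
  proof -
    obtain k s where ks: "w = (k, s)" "k \<le> K" "s < d k" using w by (auto simp: block_index_def)
    have "invertible_mat (H k)" using chol by (auto simp: block_cholesky_def)
    note inv = inv_mat_invertible_mat[OF H this]
    have one: "(1\<^sub>m (d k)) $$ (s, t) = (\<Sum>i<d k. inv_mat (H k) $$ (s, i) * H k $$ (i, t))"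
      if "t < d k" for t
      using index_mult_mat_sum[OF inv(1) H ks(3) that] unfolding inv(3) .
    have "g w = (\<Sum>t<d k. (1\<^sub>m (d k)) $$ (s, t) * g (k, t))"
      using ks by (simp add: if_distrib[of "\<lambda>x. x * _"] cong: if_cong)
    also have "\<dots> = (\<Sum>t<d k. \<Sum>i<d k. inv_mat (H k) $$ (s, i) * H k $$ (i, t) * g (k, t))"
      by (intro sum.cong refl) (simp add: one sum_distrib_right del: index_one_mat)
    also have "\<dots> = (\<Sum>i<d k. inv_mat (H k) $$ (s, i) * (\<Sum>t<d k. H k $$ (i, t) * g (k, t)))"
      by (subst sum.swap) (simp add: sum_distrib_left mult_ac)
    finally show ?thesis using ks by (simp add: Hg)
  qed
  have "c u = (\<Sum>v\<in>block_index d K. if v = u then c v else 0)"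
    using u by simp
  also have "\<dots> = (\<Sum>v\<in>block_index d K. c v * (\<Sum>w\<in>block_index d K. block_entry R v w * block_entry S w u))"
    using u by (intro sum.cong refl) (simp add: RS')
  also have "\<dots> = (\<Sum>w\<in>block_index d K. g w * block_entry S w u)"
    unfolding g_def sum_distrib_left sum_distrib_right by (subst sum.swap) (simp add: mult_ac)
  finally show ?thesis by (simp add: g)
qed

section \<open>Moment matrices under an elementary flow\<close>

definition block_monomial :: "nat \<times> nat \<Rightarrow> real ^ 'n::{finite,linorder} \<Rightarrow> real" where
  "block_monomial u x = mi_power x (mi_list (fst u) ! snd u)"

lemma integrable_block_monomial_mult:
  assumes "\<And>\<alpha> :: nat ^ 'n::{finite,linorder}. integrable \<mu> (\<lambda>x. mi_power x \<alpha>)"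
  shows "integrable \<mu> (\<lambda>x. block_monomial u x * block_monomial v x)"
  unfolding block_monomial_def mi_power_plus[symmetric] by (rule assms)

lemma block_entry_moment_matrix:
  fixes \<mu> :: "(real ^ 'n::{finite,linorder}) measure"
  assumes "u \<in> block_index (mi_count TYPE('n)) K" "v \<in> block_index (mi_count TYPE('n)) L"
  shows "block_entry (moment_matrix \<mu> w) u v
    = (\<integral>x. block_monomial u x * block_monomial v x * w x \<partial>\<mu>)"
  using assms
  by (auto simp: block_entry_def moment_matrix_def block_monomial_def elim!: block_indexE)

lemma block_entry_dot_shift_zero:
  assumes "l \<noteq> k + 1" "i < mi_count TYPE('n) k" "j < mi_count TYPE('n) l"
  shows "block_entry (dot_shift (n :: real ^ 'n::{finite,linorder})) (k, i) (l, j) = 0"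
  using assms by (simp add: block_entry_def dot_shift_def shift_matrix_def)

text \<open>The matrix of multiplication by \<open>n \<bullet> x - c\<close> on the
  monomials.\<close>

definition shift_minus :: "real ^ 'n::{finite,linorder} \<Rightarrow> real \<Rightarrow> nat \<times> nat \<Rightarrow> nat \<times> nat \<Rightarrow> real" where
  "shift_minus n c u v = block_entry (dot_shift n) u v - (if v = u then c else 0)"

text \<open>Multiplication by an affine function raises the degree by at most one, so for rows of
  degree at most \<open>k\<close> the sum cut off at \<open>Suc k\<close> is complete.\<close>

lemma shift_minus_monomials:
  fixes n x :: "real ^ 'n::{finite,linorder}"
  assumes u: "u \<in> block_index (mi_count TYPE('n)) k"
  shows "(\<Sum>v\<in>block_index (mi_count TYPE('n)) (Suc k). shift_minus n c u v * block_monomial v x)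
    = (n \<bullet> x - c) * block_monomial u x"
proof -
  obtain m i where m: "u = (m, i)" "m \<le> k" "i < mi_count TYPE('n) m" using u by (rule block_indexE)
  have "(\<Sum>v\<in>block_index (mi_count TYPE('n)) (Suc k). block_entry (dot_shift n) u v * block_monomial v x)
    = (\<Sum>j<mi_count TYPE('n) (m + 1). block_entry (dot_shift n) u (m + 1, j) * block_monomial (m + 1, j) x)"
    using m by (intro sum_block_index_single) (auto simp: block_entry_dot_shift_zero)
  also have "\<dots> = (n \<bullet> x) * block_monomial u x"
    using dot_shift_apply_monomials[OF m(3), of n x] by (simp add: m(1) block_entry_def block_monomial_def)
  finally have dot: "(\<Sum>v\<in>block_index (mi_count TYPE('n)) (Suc k).
    block_entry (dot_shift n) u v * block_monomial v x) = (n \<bullet> x) * block_monomial u x" .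
  have "(\<Sum>v\<in>block_index (mi_count TYPE('n)) (Suc k). (if v = u then c else 0) * block_monomial v x)
    = (\<Sum>v\<in>block_index (mi_count TYPE('n)) (Suc k). if v = u then c * block_monomial v x else 0)"
    by (intro sum.cong) auto
  also have "\<dots> = c * block_monomial u x" using m by simp
  finally show ?thesis using dot by (simp add: shift_minus_def left_diff_distrib sum_subtractf)
qed

text \<open>On moment matrices the flow is left multiplication by \<open>shift_minus\<close>: the
  finite sum moves inside the integral and becomes the density. Finite moments suffice for this,
  since a product of monomials is a monomial.\<close>

lemma shift_minus_moment_matrix:
  fixes \<mu> :: "(real ^ 'n::{finite,linorder}) measure"
  assumes moments: "\<And>\<alpha> :: nat ^ 'n::{finite,linorder}. integrable \<mu> (\<lambda>x. mi_power x \<alpha>)"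
    and u: "u \<in> block_index (mi_count TYPE('n)) k" and v: "v \<in> block_index (mi_count TYPE('n)) L"
  shows "(\<Sum>w\<in>block_index (mi_count TYPE('n)) (Suc k).
      shift_minus n c u w * block_entry (moment_matrix \<mu> (\<lambda>_. 1)) w v)
    = block_entry (moment_matrix \<mu> (flow_density n c)) u v"
proof -
  note int = integrable_block_monomial_mult[OF moments]
  have "(\<Sum>w\<in>block_index (mi_count TYPE('n)) (Suc k).
      shift_minus n c u w * block_entry (moment_matrix \<mu> (\<lambda>_. 1)) w v)
    = (\<Sum>w\<in>block_index (mi_count TYPE('n)) (Suc k).
      \<integral>x. shift_minus n c u w * (block_monomial w x * block_monomial v x) \<partial>\<mu>)"
    using v by (intro sum.cong refl) (simp add: block_entry_moment_matrix)
  also have "\<dots> = (\<integral>x. (\<Sum>w\<in>block_index (mi_count TYPE('n)) (Suc k).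
      shift_minus n c u w * (block_monomial w x * block_monomial v x)) \<partial>\<mu>)"
    by (intro Bochner_Integration.integral_sum[symmetric] integrable_mult_right int)
  also have "\<dots> = (\<integral>x. (\<Sum>w\<in>block_index (mi_count TYPE('n)) (Suc k).
      shift_minus n c u w * block_monomial w x) * block_monomial v x \<partial>\<mu>)"
    by (simp only: sum_distrib_right mult.assoc)
  also have "\<dots> = block_entry (moment_matrix \<mu> (flow_density n c)) u v"
    unfolding shift_minus_monomials[OF u] block_entry_moment_matrix[OF u v]
    by (simp add: flow_density_def mult_ac)
  finally show ?thesis .
qed

section \<open>Values of the orthogonal polynomials and the Christoffel relation\<close>

lemma orth_poly_carrier: "orth_poly S k (x :: real ^ 'n::{finite,linorder}) \<in> carrier_mat (mi_count TYPE('n) k) 1"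
  by (simp add: orth_poly_def)

lemma orth_poly_entry:
  fixes x :: "real ^ 'n::{finite,linorder}"
  assumes S: "block_lower_unitriangular (mi_count TYPE('n)) S"
    and i: "i < mi_count TYPE('n) k" and K: "k \<le> K"
  shows "orth_poly S k x $$ (i, 0)
    = (\<Sum>w\<in>block_index (mi_count TYPE('n)) K. block_entry S (k, i) w * block_monomial w x)"
proof -
  have "orth_poly S k x $$ (i, 0) = Sum_any (\<lambda>m. (S k m * chi_block m x) $$ (i, 0))"
    using i by (simp add: orth_poly_def)
  also have "\<dots> = (\<Sum>w\<in>block_index (mi_count TYPE('n)) K.
      block_entry S (k, i) w * chi_block (fst w) x $$ (snd w, 0))"
    using S i K by (intro Sum_any_lower_triangular[where p = 1]) (auto simp: chi_block_def)
  also have "\<dots> = (\<Sum>w\<in>block_index (mi_count TYPE('n)) K. block_entry S (k, i) w * block_monomial w x)"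
    by (intro sum.cong refl) (auto simp: chi_block_def block_monomial_def elim!: block_indexE)
  finally show ?thesis .
qed

text \<open>As polynomials in \<open>x\<close>, both sides have the same coefficients in degree \<open>k + 1\<close> and the
  same \<open>\<mu>\<close>-pairings with all monomials of degree at most \<open>k\<close>, namely \<open>0\<close> in degree below \<open>k\<close> and
  \<open>H' k\<close> in degree \<open>k\<close>.  So their difference has degree at most \<open>k\<close> and lies in the kernel of the
  truncated moment matrix.\<close>

lemma christoffel_relation:
  fixes \<mu> :: "(real ^ 'n::{finite,linorder}) measure" and n x :: "real ^ 'n::{finite,linorder}"
  assumes moments: "\<And>\<alpha> :: nat ^ 'n::{finite,linorder}. integrable \<mu> (\<lambda>x. mi_power x \<alpha>)"
    and chol: "block_cholesky (mi_count TYPE('n)) (moment_matrix \<mu> (\<lambda>_. 1)) S H"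
    and chol': "block_cholesky (mi_count TYPE('n)) (moment_matrix \<mu> (flow_density n c)) S' H'"
    and i: "i < mi_count TYPE('n) k"
  shows "(n \<bullet> x - c) * orth_poly S' k x $$ (i, 0)
    = (\<Sum>j<mi_count TYPE('n) (k + 1). dot_shift n k (k + 1) $$ (i, j) * orth_poly S (k + 1) x $$ (j, 0))
    + (\<Sum>j<mi_count TYPE('n) k. (H' k * inv_mat (H k)) $$ (i, j) * orth_poly S k x $$ (j, 0))"
proof -
  define d where "d = mi_count TYPE('n)"
  define G where "G = block_entry (moment_matrix \<mu> (\<lambda>_. 1))"
  define \<Lambda> where "\<Lambda> = (\<lambda>j. dot_shift n k (k + 1) $$ (i, j))"
  define M where "M = (\<lambda>j. (H' k * inv_mat (H k)) $$ (i, j))"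
  \<comment> \<open>\<open>a\<close> and \<open>b\<close> are the coefficients of the left and the
    right side, as polynomials in \<open>x\<close>, in the monomials of degree at most
    \<open>k + 1\<close>.\<close>
  define a where "a = (\<lambda>u. \<Sum>w\<in>block_index d k. block_entry S' (k, i) w * shift_minus n c w u)"
  define b where "b = (\<lambda>u. (\<Sum>j<d (k + 1). \<Lambda> j * block_entry S (k + 1, j) u)
    + (\<Sum>j<d k. M j * block_entry S (k, j) u))"
  note chol = chol[folded d_def] and chol' = chol'[folded d_def] and i = i[folded d_def]
  have S: "block_lower_unitriangular d S" and S': "block_lower_unitriangular d S'"
    and H: "H k \<in> carrier_mat (d k) (d k)" "invertible_mat (H k)"
    and H': "H' k \<in> carrier_mat (d k) (d k)"
    using chol chol' by (auto simp: block_cholesky_def)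
  \<comment> \<open>In degree \<open>k + 1\<close> only unit diagonal blocks count: on the left that
    of \<open>S'\<close> in block \<open>k\<close>, followed by the shift, and on the right that of
    \<open>S\<close> in block \<open>k + 1\<close>. The constant \<open>c\<close> does not raise the
    degree.\<close>
  have top: "a (Suc k, j) = b (Suc k, j)" if j: "j < d (Suc k)" for j
  proof -
    have \<Lambda>: "block_entry (dot_shift n) (k, i) (Suc k, j) = \<Lambda> j"
      by (simp add: \<Lambda>_def block_entry_def)
    have "a (Suc k, j) = (\<Sum>t<d k. block_entry S' (k, i) (k, t) * shift_minus n c (k, t) (Suc k, j))"
      unfolding a_def using j
      by (intro sum_block_index_single)
        (auto simp: shift_minus_def d_def block_entry_dot_shift_zero)
    also have "\<dots> = (\<Sum>t<d k. if t = i then \<Lambda> j else 0)"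
      using i by (intro sum.cong refl)
        (auto simp: block_lower_unitriangular_diag[OF S'] shift_minus_def \<Lambda>)
    also have "\<dots> = \<Lambda> j" using i by simp
    finally have "a (Suc k, j) = \<Lambda> j" .
    moreover have "(\<Sum>s<d (Suc k). \<Lambda> s * block_entry S (Suc k, s) (Suc k, j))
      = (\<Sum>s<d (Suc k). if s = j then \<Lambda> s else 0)"
      using j by (intro sum.cong refl) (auto simp: block_lower_unitriangular_diag[OF S])
    moreover have "(\<Sum>s<d k. M s * block_entry S (k, s) (Suc k, j)) = 0"
      using j by (intro sum.neutral) (auto simp: block_lower_unitriangular_zero[OF S])
    ultimately show ?thesis using j by (simp add: b_def)
  qed
  \<comment> \<open>The shift turns pairings for \<open>\<mu>\<close> into pairings for the flowed
    measure, where \<open>S'\<close> provides the orthogonality.\<close>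
  have aG: "(\<Sum>u\<in>block_index d (Suc k). a u * G u (l, t)) = (if l = k then H' k $$ (i, t) else 0)"
    if l: "l \<le> k" "t < d l" for l t
  proof -
    have "(\<Sum>u\<in>block_index d (Suc k). a u * G u (l, t))
      = (\<Sum>w\<in>block_index d k. block_entry S' (k, i) w *
          (\<Sum>u\<in>block_index d (Suc k). shift_minus n c w u * G u (l, t)))"
      unfolding a_def sum_distrib_left sum_distrib_right by (subst sum.swap) (simp add: mult_ac)
    also have "\<dots> = (\<Sum>w\<in>block_index d k. block_entry S' (k, i) w *
        block_entry (moment_matrix \<mu> (flow_density n c)) w (l, t))"
      using l by (intro sum.cong refl arg_cong2[where f = "(*)"])
        (auto simp: G_def d_def intro!: shift_minus_moment_matrix[OF moments, of _ _ _ k])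
    also have "\<dots> = (if l = k then H' k $$ (i, t) else 0)"
      using l i by (intro block_cholesky_orthogonal[OF chol']) auto
    finally show ?thesis .
  qed
  have bG: "(\<Sum>u\<in>block_index d (Suc k). b u * G u (l, t)) = (if l = k then H' k $$ (i, t) else 0)"
    if l: "l \<le> k" "t < d l" for l t
  proof -
    have "(\<Sum>u\<in>block_index d (Suc k). b u * G u (l, t))
      = (\<Sum>j<d (k + 1). \<Lambda> j * (\<Sum>u\<in>block_index d (Suc k). block_entry S (k + 1, j) u * G u (l, t)))
      + (\<Sum>j<d k. M j * (\<Sum>u\<in>block_index d (Suc k). block_entry S (k, j) u * G u (l, t)))"
      unfolding b_def distrib_right sum.distrib sum_distrib_left sum_distrib_right
      by (intro arg_cong2[where f = "(+)"]; subst sum.swap) (simp_all add: mult_ac)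
    \<comment> \<open>Block \<open>k + 1\<close> of \<open>S\<close> is orthogonal to all degrees up
      to \<open>k\<close>, so only the \<open>M\<close> term remains; \<open>M\<close> is the row of
      \<open>H' k * inv_mat (H k)\<close> that turns \<open>H k\<close> into
      \<open>H' k\<close>.\<close>
    also have "(\<Sum>j<d (k + 1). \<Lambda> j * (\<Sum>u\<in>block_index d (Suc k). block_entry S (k + 1, j) u * G u (l, t))) = 0"
      using l by (intro sum.neutral) (auto simp: G_def block_cholesky_orthogonal[OF chol])
    also have "(\<Sum>j<d k. M j * (\<Sum>u\<in>block_index d (Suc k). block_entry S (k, j) u * G u (l, t)))
      = (\<Sum>j<d k. M j * (if l = k then H k $$ (j, t) else 0))"
      using l by (intro sum.cong refl) (auto simp: G_def block_cholesky_orthogonal[OF chol])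
    also have "\<dots> = (if l = k then H' k $$ (i, t) else 0)"
    proof (cases "l = k")
      case True
      note inv = inv_mat_invertible_mat[OF H]
      have "(\<Sum>j<d k. M j * H k $$ (j, t)) = (H' k * inv_mat (H k) * H k) $$ (i, t)"
        unfolding M_def using True l i H H' inv
        by (intro index_mult_mat_sum[symmetric, of _ "d k" _ _ "d k"]) auto
      also have "H' k * inv_mat (H k) * H k = H' k"
        using H H' inv by (simp add: assoc_mult_mat[OF H' inv(1) H(1)])
      finally show ?thesis using True by simp
    qed simp
    finally show ?thesis by simp
  qed
  \<comment> \<open>Nondegeneracy is used on blocks up to \<open>k\<close>. As the coefficients in
    block \<open>Suc k\<close> agree, the vanishing pairings over \<open>Suc k\<close> restrict to
    that range.\<close>
  have low: "a u - b u = 0" if u: "u \<in> block_index d k" for u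
  proof (rule block_cholesky_nondegenerate[OF chol _ _ u])
    show "block_entry (moment_matrix \<mu> (\<lambda>_. 1)) v w = block_entry (moment_matrix \<mu> (\<lambda>_. 1)) w v"
      if "v \<in> block_index d k" "w \<in> block_index d k" for v w
      using that unfolding d_def by (simp add: block_entry_moment_matrix mult_ac)
    show "(\<Sum>u\<in>block_index d k. (a u - b u) * block_entry (moment_matrix \<mu> (\<lambda>_. 1)) u v) = 0"
      if v: "v \<in> block_index d k" for v
    proof -
      obtain l t where "v = (l, t)" "l \<le> k" "t < d l" using v by (rule block_indexE)
      then have "(\<Sum>u\<in>block_index d (Suc k). (a u - b u) * G u v) = 0"
        by (simp add: left_diff_distrib sum_subtractf aG bG)
      then show ?thesis by (simp add: sum_block_index_Suc top G_def)
    qed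
  qed
  have ab: "a u = b u" if "u \<in> block_index d (Suc k)" for u
    using that top low by (auto simp: le_Suc_eq elim!: block_indexE)
  have "(n \<bullet> x - c) * orth_poly S' k x $$ (i, 0)
    = (\<Sum>w\<in>block_index d k. block_entry S' (k, i) w * ((n \<bullet> x - c) * block_monomial w x))"
    unfolding d_def orth_poly_entry[OF S'[unfolded d_def] i[unfolded d_def] order_refl] sum_distrib_left
    by (simp add: mult_ac)
  also have "\<dots> = (\<Sum>w\<in>block_index d k. block_entry S' (k, i) w *
      (\<Sum>u\<in>block_index d (Suc k). shift_minus n c w u * block_monomial u x))"
    unfolding d_def by (intro sum.cong refl) (simp add: shift_minus_monomials)
  also have "\<dots> = (\<Sum>u\<in>block_index d (Suc k). a u * block_monomial u x)"
    unfolding a_def sum_distrib_left sum_distrib_right by (subst sum.swap) (simp add: mult_ac)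
  also have "\<dots> = (\<Sum>u\<in>block_index d (Suc k). b u * block_monomial u x)"
    by (simp add: ab)
  also have "\<dots> = (\<Sum>j<d (k + 1). \<Lambda> j * (\<Sum>u\<in>block_index d (Suc k). block_entry S (k + 1, j) u * block_monomial u x))
      + (\<Sum>j<d k. M j * (\<Sum>u\<in>block_index d (Suc k). block_entry S (k, j) u * block_monomial u x))"
    unfolding b_def distrib_right sum.distrib sum_distrib_left sum_distrib_right
    by (intro arg_cong2[where f = "(+)"]; subst sum.swap) (simp_all add: mult_ac)
  also have "\<dots> = (\<Sum>j<d (k + 1). \<Lambda> j * orth_poly S (k + 1) x $$ (j, 0))
      + (\<Sum>j<d k. M j * orth_poly S k x $$ (j, 0))"
    unfolding d_def using S[unfolded d_def]
    by (intro arg_cong2[where f = "(+)"] sum.cong refl) (auto simp: orth_poly_entry[where K = "Suc k"])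
  finally show ?thesis by (simp add: \<Lambda>_def M_def d_def)
qed

section \<open>Stacking and the pseudo-inverse\<close>

text \<open>If the Gram matrix annihilated a nonzero \<open>v\<close>, the squared length of
  \<open>A v\<close> would be the scalar product of \<open>A^T A v\<close> with \<open>v\<close>,
  hence zero; then \<open>A v = 0\<close>, contradicting the trivial kernel. So the inverse inside
  \<open>pinv_mat\<close> is a genuine one.\<close>

lemma pinv_mat_left_inverse:
  assumes A: "A \<in> carrier_mat m n"
    and ker: "\<And>v j. (\<And>i. i < m \<Longrightarrow> (\<Sum>j<n. A $$ (i, j) * v j) = 0) \<Longrightarrow> j < n \<Longrightarrow> v j = 0"
  shows "pinv_mat A \<in> carrier_mat n m" "pinv_mat A * A = 1\<^sub>m n"
proof -
  let ?C = "transpose_mat A * A"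
  have C: "?C \<in> carrier_mat n n" using A by simp
  have "Determinant.det ?C \<noteq> 0"
  proof
    assume "Determinant.det ?C = 0"
    then obtain v where v: "v \<in> carrier_vec n" "v \<noteq> 0\<^sub>v n" "?C *\<^sub>v v = 0\<^sub>v n"
      using det_0_iff_vec_prod_zero_field[OF C] by auto
    define y where "y = A *\<^sub>v v"
    have y: "y \<in> carrier_vec m" using A v by (simp add: y_def)
    have "scalar_prod y y = scalar_prod (transpose_mat A *\<^sub>v y) v"
      using transpose_vec_mult_scalar[OF A v(1) y] by (simp add: y_def)
    also have "transpose_mat A *\<^sub>v y = ?C *\<^sub>v v"
      unfolding y_def using A v by (intro assoc_mult_mat_vec[symmetric]) auto
    finally have "(\<Sum>i<m. (vec_index y i)\<^sup>2) = 0"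
      using v y by (simp add: scalar_prod_def power2_eq_square atLeast0LessThan)
    then have y0: "vec_index y i = 0" if "i < m" for i
      using that by (simp add: sum_nonneg_eq_0_iff)
    have "vec_index v j = 0" if "j < n" for j
    proof (rule ker[OF _ that])
      fix i assume i: "i < m"
      then show "(\<Sum>j<n. A $$ (i, j) * vec_index v j) = 0"
        using y0[OF i] A v by (simp add: y_def scalar_prod_def atLeast0LessThan)
    qed
    then have "v = 0\<^sub>v n" using v by (intro eq_vecI) auto
    with v show False by simp
  qed
  from det_non_zero_imp_unit[OF C this, of "()"] obtain B
    where "B \<in> carrier_mat n n" "B * ?C = 1\<^sub>m n"
    by (auto simp: Units_def ring_mat_def)
  note inv = inv_mat[OF C this]
  show "pinv_mat A \<in> carrier_mat n m" using inv A by (simp add: pinv_mat_def)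
  show "pinv_mat A * A = 1\<^sub>m n" using inv A by (simp add: pinv_mat_def assoc_mult_mat[of _ n n _ m _ n])
qed

lemma stack_mat_carrier:
  "stack_mat r c (A :: 'n::{finite,linorder} \<Rightarrow> real mat) \<in> carrier_mat (CARD('n) * r) c"
  by (simp add: stack_mat_def)

text \<open>The block \<open>a\<close> and its row \<open>s\<close> do not depend on the matrices
  stacked, so one pair serves both \<open>stacked_shift\<close> and
  \<open>stacked_tau\<close>.\<close>

lemma stack_mat_rowE:
  assumes "i < CARD('n::{finite,linorder}) * r"
  obtains a :: "'n::{finite,linorder}" and s where "s < r"
    and "\<And>c A j. j < c \<Longrightarrow> stack_mat r c A $$ (i, j) = A a $$ (s, j)"
proof -
  have "0 < r" using assms by (cases r) auto
  with that[of "i mod r" "sorted_list_of_set (UNIV :: 'n set) ! (i div r)"] show thesis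
    using assms by (simp add: stack_mat_def)
qed

text \<open>Conversely, each row of each block occurs in the stack, so a kernel vector of the stack
  lies in the kernel of every block.\<close>

lemma stack_mat_entry_surj:
  fixes a :: "'n::{finite,linorder}"
  assumes "s < r"
  obtains i where "i < CARD('n::{finite,linorder}) * r"
    and "\<And>c A j. j < c \<Longrightarrow> stack_mat r c A $$ (i, j) = A a $$ (s, j)"
proof -
  have "a \<in> set (sorted_list_of_set (UNIV :: 'n set))" by simp
  then obtain m where m: "m < CARD('n)" "sorted_list_of_set (UNIV :: 'n set) ! m = a"
    by (metis in_set_conv_nth length_sorted_list_of_set)
  let ?i = "m * r + s"
  have "?i < Suc m * r" using assms by simp
  also have "\<dots> \<le> CARD('n) * r" using m by (intro mult_right_mono) auto
  finally have "?i < CARD('n) * r" .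
  moreover have "?i div r = m" "?i mod r = s" using assms by auto
  ultimately show thesis
    using m assms by (intro that[of ?i]) (auto simp: stack_mat_def)
qed

lemma stacked_shift_carrier:
  "stacked_shift (N :: real ^ 'n::{finite,linorder} ^ 'n::{finite,linorder}) k
    \<in> carrier_mat (CARD('n) * mi_count TYPE('n) k) (mi_count TYPE('n) (k + 1))"
  unfolding stacked_shift_def by (rule stack_mat_carrier)

lemma pinv_stacked_shift:
  fixes N :: "real ^ 'n::{finite,linorder} ^ 'n::{finite,linorder}"
  assumes N: "invertible N"
  shows "pinv_mat (stacked_shift N k)
      \<in> carrier_mat (mi_count TYPE('n) (k + 1)) (CARD('n) * mi_count TYPE('n) k)"
    "pinv_mat (stacked_shift N k) * stacked_shift N k = 1\<^sub>m (mi_count TYPE('n) (k + 1))"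
proof -
  have ker: "v j = 0"
    if zero: "\<And>i. i < CARD('n) * mi_count TYPE('n) k \<Longrightarrow>
        (\<Sum>j<mi_count TYPE('n) (k + 1). stacked_shift N k $$ (i, j) * v j) = 0"
      and j: "j < mi_count TYPE('n) (k + 1)" for v j
  proof (rule dot_shift_kernel_trivial[OF N _ j])
    fix a :: 'n and s assume "s < mi_count TYPE('n) k"
    then obtain i where i: "i < CARD('n) * mi_count TYPE('n) k"
      "\<And>c A j. j < c \<Longrightarrow> stack_mat (mi_count TYPE('n) k) c A $$ (i, j) = A a $$ (s, j)"
      by (rule stack_mat_entry_surj[where a = a]) blast
    show "(\<Sum>j<mi_count TYPE('n) (k + 1). dot_shift (N $ a) k (k + 1) $$ (s, j) * v j) = 0"
      using zero[OF i(1)] by (simp add: stacked_shift_def i(2))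
  qed
  note pinv = pinv_mat_left_inverse[OF stacked_shift_carrier[of N k]]
  show "pinv_mat (stacked_shift N k)
      \<in> carrier_mat (mi_count TYPE('n) (k + 1)) (CARD('n) * mi_count TYPE('n) k)"
    by (rule pinv(1)) (rule ker)
  show "pinv_mat (stacked_shift N k) * stacked_shift N k = 1\<^sub>m (mi_count TYPE('n) (k + 1))"
    by (rule pinv(2)) (rule ker)
qed

section \<open>Iterating the recursion down to degree zero\<close>

lemma smult_smult_assoc_mat: "a \<cdot>\<^sub>m (b \<cdot>\<^sub>m A) = (a * b :: 'a::semigroup_mult) \<cdot>\<^sub>m A"
  by (rule eq_matI) (auto simp: mult.assoc)

lemma descending_prod_0: "descending_prod F 0 = 1\<^sub>m (dim_col (F 0))"
  by (simp add: descending_prod_def)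

lemma descending_prod_Suc: "descending_prod F (Suc k) = F k * descending_prod F k"
  by (simp add: descending_prod_def)

theorem theorem3p2p1:
  fixes \<Omega> :: "(real ^ 'n::{finite,linorder}) set"
    and \<mu> :: "(real ^ 'n::{finite,linorder}) measure"
    and N :: "real ^ 'n::{finite,linorder} ^ 'n::{finite,linorder}"
    and q :: "real ^ 'n::{finite,linorder}"
    and S :: block_mat and H :: "nat \<Rightarrow> real mat"
    and TS :: "'n \<Rightarrow> block_mat" and TH :: "'n \<Rightarrow> nat \<Rightarrow> real mat"
    and k :: nat
  assumes borel_on: "sets \<mu> = sets (restrict_space borel \<Omega>)"
    and moments: "\<And>\<alpha> :: nat ^ 'n::{finite,linorder}. integrable \<mu> (\<lambda>x. mi_power x \<alpha>)"
    and cholesky: "block_cholesky (mi_count TYPE('n)) (moment_matrix \<mu> (\<lambda>_. 1)) S H"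
    and N_inv: "invertible N"
    and Nq_nonzero: "\<And>a. (N *v q) $ a \<noteq> 0"
    and T_cholesky: "\<And>a. block_cholesky (mi_count TYPE('n))
          (moment_matrix \<mu> (flow_density (N $ a) ((N *v q) $ a))) (TS a) (TH a)"
    and k: "k \<ge> 1"
  shows "orth_poly S k q =
    (-1) ^ k \<cdot>\<^sub>m
      descending_prod
        (\<lambda>j. pinv_mat (stacked_shift N j) * stacked_tau TH j * inv_mat (H j)) k"
proof -
  define d where "d = mi_count TYPE('n)"
  define F where "F = (\<lambda>j. pinv_mat (stacked_shift N j) * stacked_tau TH j * inv_mat (H j))"
  have S: "block_lower_unitriangular d S"
    using cholesky by (auto simp: block_cholesky_def d_def)
  have H: "H j \<in> carrier_mat (d j) (d j)" "invertible_mat (H j)" for j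
    using cholesky by (auto simp: block_cholesky_def d_def)
  have TH: "TH a j \<in> carrier_mat (d j) (d j)" for a j
    using T_cholesky[of a] by (auto simp: block_cholesky_def d_def)
  note inv = inv_mat_invertible_mat(1)[OF H]
  have A: "stacked_shift N j \<in> carrier_mat (CARD('n) * d j) (d (Suc j))" for j
    using stacked_shift_carrier[of N j] by (simp add: d_def)
  have pinv: "pinv_mat (stacked_shift N j) \<in> carrier_mat (d (Suc j)) (CARD('n) * d j)"
    "pinv_mat (stacked_shift N j) * stacked_shift N j = 1\<^sub>m (d (Suc j))" for j
    using pinv_stacked_shift[OF N_inv, of j] by (simp_all add: d_def)
  have T: "stacked_tau TH j \<in> carrier_mat (CARD('n) * d j) (d j)" for j
    unfolding stacked_tau_def d_def by (rule stack_mat_carrier)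
  have P: "orth_poly S j q \<in> carrier_mat (d j) 1" for j
    unfolding d_def by (rule orth_poly_carrier)
  have F: "F j \<in> carrier_mat (d (Suc j)) (d j)" for j
    unfolding F_def using pinv T inv by (meson mult_carrier_mat)
  have d0: "d 0 = 1" by (simp add: d_def mi_count_0)
  have relation: "stacked_shift N j * orth_poly S (Suc j) q
    = (-1) \<cdot>\<^sub>m (stacked_tau TH j * inv_mat (H j) * orth_poly S j q)" for j
  proof (rule eq_matI)
    fix i s assume "i < dim_row ((-1) \<cdot>\<^sub>m (stacked_tau TH j * inv_mat (H j) * orth_poly S j q))"
      and "s < dim_col ((-1) \<cdot>\<^sub>m (stacked_tau TH j * inv_mat (H j) * orth_poly S j q))"
    then have i: "i < CARD('n) * d j" and s: "s = 0" using T[of j] P[of j] by auto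
    obtain a :: 'n and r where r: "r < d j"
      and row: "\<And>c A t. t < c \<Longrightarrow> stack_mat (d j) c A $$ (i, t) = A a $$ (r, t)"
      using i by (rule stack_mat_rowE) blast
    \<comment> \<open>The constant in the flow density is the value of the linear form at
      \<open>q\<close>, so the left side of \<open>christoffel_relation\<close> vanishes
      there.\<close>
    have "(N *v q) $ a = N $ a \<bullet> q"
      by (simp add: matrix_vector_mult_def inner_vec_def)
    then have "(\<Sum>t<d (Suc j). dot_shift (N $ a) j (Suc j) $$ (r, t) * orth_poly S (Suc j) q $$ (t, 0))
      + (\<Sum>t<d j. (TH a j * inv_mat (H j)) $$ (r, t) * orth_poly S j q $$ (t, 0)) = 0"
      using christoffel_relation[OF moments cholesky T_cholesky[of a] r[unfolded d_def], of q]
      by (simp add: d_def)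
    moreover have "(stacked_shift N j * orth_poly S (Suc j) q) $$ (i, 0)
      = (\<Sum>t<d (Suc j). dot_shift (N $ a) j (Suc j) $$ (r, t) * orth_poly S (Suc j) q $$ (t, 0))"
      using row by (subst index_mult_mat_sum[OF A P i]) (simp_all add: stacked_shift_def d_def)
    moreover have "(stacked_tau TH j * inv_mat (H j) * orth_poly S j q) $$ (i, 0)
      = (\<Sum>t<d j. (TH a j * inv_mat (H j)) $$ (r, t) * orth_poly S j q $$ (t, 0))"
    proof -
      \<comment> \<open>Right multiplication acts on each stacked block separately.\<close>
      have "(stacked_tau TH j * inv_mat (H j)) $$ (i, t) = (TH a j * inv_mat (H j)) $$ (r, t)"
        if "t < d j" for t
        unfolding index_mult_mat_sum[OF T inv i that] index_mult_mat_sum[OF TH inv r that]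
        using row by (simp add: stacked_tau_def d_def)
      then show ?thesis
        by (subst index_mult_mat_sum[OF mult_carrier_mat[OF T inv] P i]) simp_all
    qed
    ultimately show "(stacked_shift N j * orth_poly S (Suc j) q) $$ (i, s)
      = ((-1) \<cdot>\<^sub>m (stacked_tau TH j * inv_mat (H j) * orth_poly S j q)) $$ (i, s)"
      using i s T[of j] P[of j] by simp
  qed (use A[of j] T[of j] P[of j] P[of "Suc j"] in auto)
  \<comment> \<open>The pseudo-inverse is a left inverse of the stacked shift and isolates the next
    block; each such step contributes one sign.\<close>
  have step: "orth_poly S (Suc j) q = (-1) \<cdot>\<^sub>m (F j * orth_poly S j q)" for j
  proof -
    have TiP: "stacked_tau TH j * inv_mat (H j) * orth_poly S j q \<in> carrier_mat (CARD('n) * d j) 1"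
      by (intro mult_carrier_mat[OF mult_carrier_mat[OF T inv] P])
    have "orth_poly S (Suc j) q = pinv_mat (stacked_shift N j) * (stacked_shift N j * orth_poly S (Suc j) q)"
      using pinv(2)[of j] P[of "Suc j"] by (simp add: assoc_mult_mat[OF pinv(1) A P, symmetric])
    also have "\<dots> = (-1) \<cdot>\<^sub>m (pinv_mat (stacked_shift N j) *
        (stacked_tau TH j * inv_mat (H j) * orth_poly S j q))"
      unfolding relation by (rule mult_smult_distrib[OF pinv(1) TiP])
    also have "pinv_mat (stacked_shift N j) * (stacked_tau TH j * inv_mat (H j) * orth_poly S j q)
        = F j * orth_poly S j q"
      unfolding F_def
      by (simp add: assoc_mult_mat[OF pinv(1) mult_carrier_mat[OF T inv] P, symmetric]
          assoc_mult_mat[OF pinv(1) T inv])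
    finally show ?thesis .
  qed
  \<comment> \<open>The dimensions of the product are carried through the induction because moving
    the scalar out of the next matrix product requires them.\<close>
  have "descending_prod F k \<in> carrier_mat (d k) 1 \<and> orth_poly S k q = (-1) ^ k \<cdot>\<^sub>m descending_prod F k" for k
  proof (induction k)
    case 0
    \<comment> \<open>Block 0 holds only the monomial 1, and \<open>S 0 0\<close> is the unit
      matrix. The value 1 matches the empty product, whose size \<open>dim_col (F 0)\<close> is
      \<open>d 0 = 1\<close>.\<close>
    have "orth_poly S 0 q $$ (0, 0) = 1"
      using orth_poly_entry[of S 0 0 0 q] S d0
      by (simp add: d_def sum_block_index block_lower_unitriangular_diag block_monomial_def
          mi_power_def mi_list_0)
    then have "orth_poly S 0 q = 1\<^sub>m 1"
      using P[of 0] d0 by (intro eq_matI) auto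
    then show ?case using F[of 0] d0 by (auto simp: descending_prod_0)
  next
    case (Suc k)
    then have "orth_poly S (Suc k) q = (-1) \<cdot>\<^sub>m (F k * ((-1) ^ k \<cdot>\<^sub>m descending_prod F k))"
      by (simp add: step)
    also have "\<dots> = (-1) ^ Suc k \<cdot>\<^sub>m descending_prod F (Suc k)"
      using mult_smult_distrib[OF F conjunct1[OF Suc]] by (simp add: descending_prod_Suc smult_smult_assoc_mat)
    finally show ?case using mult_carrier_mat[OF F conjunct1[OF Suc]] by (simp add: descending_prod_Suc)
  qed
  then show ?thesis by (simp add: F_def)
qed

end
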